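(* A pair $(a,b)$ of positive integers is a strongly carefree couple if $a$ and $b$ are relatively prime and both squarefree. For real $N,R\ge1$ let \[\mathcal{S}(N,R)=\#\{(a,b)\in\mathbf{Z}_{\ge1}^2:(a,b)\text{ strongly carefree},\ ab\le N,\ 1/R\le a/b\le R\},\] \[\mathcal{S}_{\mathrm{II}}(N,R)=\#\{(a,b)\text{ counted in }\mathcal{S}(N,R):3\nmid ab,\ a^2\equiv b^2\pmod 9\},\] and $\mathcal{S}_{\mathrm{I}}(N,R)=\mathcal{S}(N,R)-\mathcal{S}_{\mathrm{II}}(N,R)$. Then for fixed $R$, as $N\to\infty$, \begin{align*} \mathcal{S}_{\mathrm{I}}(N,R)&=\frac{4C}{5}N\log R+o(N),\\ \mathcal{S}_{\mathrm{II}}(N,R)&=\frac{C}{5}N\log R+o(N),\\ \mathcal{S}(N,R)&=CN\log R+o(N), \end{align*} where $C=\prod_p\left(1-\frac{3}{p^2}+\frac{2}{p^3}\right)$, the product over all primes. *)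

theory Defs
  imports
    "HOL-Analysis.Analysis"
    "HOL-Number_Theory.Number_Theory"
    "HOL-Computational_Algebra.Squarefree"
    "HOL-Library.Landau_Symbols"
begin

definition strongly_carefree :: "nat \<Rightarrow> nat \<Rightarrow> bool" where
  "strongly_carefree a b \<longleftrightarrow>
     a \<ge> 1 \<and> b \<ge> 1 \<and> coprime a b \<and> squarefree a \<and> squarefree b"

definition carefree_couples :: "real \<Rightarrow> real \<Rightarrow> (nat \<times> nat) set" where
  "carefree_couples N R =
     {(a, b). strongly_carefree a b \<and> real a * real b \<le> N \<and>
              1 / R \<le> real a / real b \<and> real a / real b \<le> R}"

definition carefree_couples_II :: "real \<Rightarrow> real \<Rightarrow> (nat \<times> nat) set" where
  "carefree_couples_II N R =
     {(a, b) \<in> carefree_couples N R. \<not> 3 dvd a * b \<and> [a\<^sup>2 = b\<^sup>2] (mod 9)}"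

lemma finite_carefree_couples: "finite (carefree_couples N R)"
proof (rule finite_subset)
  show "carefree_couples N R \<subseteq> {..nat \<lfloor>N\<rfloor>} \<times> {..nat \<lfloor>N\<rfloor>}"
  proof (clarsimp simp: carefree_couples_def strongly_carefree_def)
    fix a b :: nat
    assume ab: "Suc 0 \<le> a" "Suc 0 \<le> b" "real a * real b \<le> N"
    have "real a * 1 \<le> real a * real b" "1 * real b \<le> real a * real b"
      using ab by (intro mult_left_mono mult_right_mono; simp)+
    with ab(3) have "real a \<le> N" "real b \<le> N" by linarith+
    then show "a \<le> nat \<lfloor>N\<rfloor> \<and> b \<le> nat \<lfloor>N\<rfloor>"
      by (simp add: le_nat_floor)
  qed
qed simp

definition S :: "real \<Rightarrow> real \<Rightarrow> real" where
  "S N R = real (card (carefree_couples N R))"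

definition S_II :: "real \<Rightarrow> real \<Rightarrow> real" where
  "S_II N R = real (card (carefree_couples_II N R))"

definition S_I :: "real \<Rightarrow> real \<Rightarrow> real" where
  "S_I N R = S N R - S_II N R"

definition carefree_factor :: "nat \<Rightarrow> real" where
  "carefree_factor n = (if prime n then 1 - 3 / real n ^ 2 + 2 / real n ^ 3 else 1)"

definition carefree_const :: real where
  "carefree_const = (\<Prod>n. carefree_factor n)"

text \<open>The product converges, so \<^const>\<open>carefree_const\<close> is not a default value of
  \<^const>\<open>prodinf\<close>.\<close>

lemma convergent_prod_carefree_factor: "convergent_prod carefree_factor"
proof (rule abs_convergent_prod_imp_convergent_prod,
       unfold abs_convergent_prod_conv_summable, rule summable_comparison_test')
  show "summable (\<lambda>n. 5 * inverse (real n ^ 2))"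
    by (intro summable_mult inverse_power_summable) simp
next
  fix n :: nat
  assume "n \<ge> 1"
  then have n: "real n \<ge> 1" by simp
  have "real n ^ 2 \<le> real n ^ 3"
    using n by (intro power_increasing) auto
  then have "2 / real n ^ 3 \<le> 2 / real n ^ 2"
    using n by (intro divide_left_mono) auto
  moreover have "0 \<le> 2 / real n ^ 3" "0 \<le> 3 / real n ^ 2" by auto
  ultimately have "\<bar>2 / real n ^ 3 - 3 / real n ^ 2\<bar> \<le> 2 / real n ^ 2 + 3 / real n ^ 2"
    by linarith
  also have "\<dots> = 5 * inverse (real n ^ 2)" by (simp add: field_simps)
  finally show "norm (norm (carefree_factor n - 1)) \<le> 5 * inverse (real n ^ 2)"
    by (auto simp: carefree_factor_def)
qed

end

(* Being strongly carefree is the conjunction over the primes p of a condition on (a, b) modulo p^2,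
   and type II only replaces the condition at 3.  For the primes up to z the Chinese remainder theorem
   turns the conditions into a union of residue classes modulo a fixed number, and each class has the
   same share of the lattice points of the region xy <= N, 1/R <= x/y <= R, whose area is N ln R.
   The primes p > z remove at most the sum of 3RN/p^2 <= 3RN/z points.  Let N tend to infinity and
   then z.  At 3, type II admits 12 of the 60 strongly carefree classes modulo 9, whence the
   factor 1/5. *)
theory Submission
  imports Defs "HOL-Real_Asymp.Real_Asymp"
begin

text \<open>The order of the two limits shapes the argument. The error of the lattice point count
  depends on the modulus, which grows with z, so that count is used only for fixed z; the tail over
  p > z must then be bounded uniformly in N. This works because the region lies in the box of
  positive pairs up to X = floor (sqrt (R N)). There the multiples of d number at most X / d in each
  coordinate, with no additive error that would accumulate over the primes, and a prime above X
  divides no coordinate. The points are counted row by row. After scaling by sqrt N the rows are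
  sample points of a Riemann sum of slice lengths. The slice length is Lipschitz even at 0, although
  1 / y is not, because the hyperbola bounds the slice only from y = 1 / sqrt R on. For a fixed
  modulus this gives an explicit error of order sqrt N.\<close>

section \<open>The slice length of the scaled region and its integral\<close>

text \<open>Length of the horizontal slice at height \<open>y\<close> of the region \<open>x * y \<le> 1\<close>, \<open>1 / R \<le> x / y \<le> R\<close>;
  at \<open>y = 0\<close> the convention \<open>1 / 0 = 0\<close> gives the correct value \<open>0\<close>.\<close>
definition slice_length :: "real \<Rightarrow> real \<Rightarrow> real" where
  "slice_length R y = max 0 (min (y * R) (1 / y) - y / R)"

text \<open>The line \<open>y * R\<close> has slope R, and the hyperbola is the smaller branch only
  for y at least 1 / sqrt R, where its slope is at most R in absolute value. The cases follow which
  branch is active at \<open>x\<close> and at \<open>y\<close>; at \<open>x = 0\<close> both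
  branches are 0.\<close>

lemma min_mult_inverse_lipschitz:
  fixes R :: real
  assumes R: "R > 0" and xy: "0 \<le> x" "x \<le> y"
  shows "\<bar>min (y * R) (1 / y) - min (x * R) (1 / x)\<bar> \<le> R * (y - x)"
proof (cases "x = 0")
  case True
  then show ?thesis using assms by (auto simp: min_def mult.commute)
next
  case False
  then have x: "x > 0" and y: "y > 0" using xy by auto
  \<comment> \<open>The minimum changes from the line to the hyperbola between \<open>x\<close> and
    \<open>y\<close>. The bound comes from R (y - x)^2 >= 0 together with R x^2 <= 1, divided by
    y.\<close>
  have key: "\<bar>1 / y - x * R\<bar> \<le> R * (y - x)" if "x * R \<le> 1 / x" "1 / y \<le> y * R"
  proof -
    have "R * x\<^sup>2 \<le> 1" using that x by (simp add: field_simps power2_eq_square)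
    moreover have "R * (y - x)\<^sup>2 \<ge> 0" using R by simp
    ultimately have "2 * R * x * y \<le> R * y\<^sup>2 + 1"
      by (simp add: power2_eq_square algebra_simps)
    then have "x * R - 1 / y \<le> R * (y - x)"
      using y by (simp add: field_simps power2_eq_square)
    moreover have "1 / y - x * R \<le> R * (y - x)" using that by (simp add: algebra_simps)
    ultimately show ?thesis by linarith
  qed
  have key2: "\<bar>1 / y - 1 / x\<bar> \<le> R * (y - x)" if "1 / x \<le> x * R"
  proof -
    have "1 \<le> R * (x * x)" using that x by (simp add: field_simps)
    also have "\<dots> \<le> R * (x * y)" using R x xy by (intro mult_left_mono) auto
    finally have "1 * (y - x) \<le> R * (x * y) * (y - x)" using xy by (intro mult_right_mono) auto
    then have "1 / x - 1 / y \<le> R * (y - x)" using x y by (simp add: field_simps)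
    moreover have "1 / y \<le> 1 / x" using x xy by (simp add: field_simps)
    ultimately show ?thesis by linarith
  qed
  show ?thesis
  proof (cases "1 / x \<le> x * R")
    case True
    then have "1 \<le> R * (x * x)" using x by (simp add: field_simps)
    also have "\<dots> \<le> R * (y * y)" using R x xy by (intro mult_left_mono mult_mono) auto
    finally have "1 / y \<le> y * R" using y by (simp add: field_simps)
    then show ?thesis using key2[OF True] True by (simp add: min_def)
  next
    case F: False
    show ?thesis
    proof (cases "1 / y \<le> y * R")
      case True
      then show ?thesis using key F by (simp add: min_def)
    next
      case False
      then show ?thesis using F xy R by (auto simp: min_def algebra_simps mult_left_mono)
    qed
  qed
qed

lemma slice_length_lipschitz:
  assumes R: "R \<ge> 1" and xy: "0 \<le> x" "x \<le> y"
  shows "\<bar>slice_length R y - slice_length R x\<bar> \<le> 2 * R * (y - x)"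
proof -
  have "\<bar>slice_length R y - slice_length R x\<bar>
      \<le> \<bar>min (y * R) (1 / y) - min (x * R) (1 / x)\<bar> + \<bar>y / R - x / R\<bar>"
    unfolding slice_length_def by linarith
  also have "\<bar>y / R - x / R\<bar> = (y - x) / R"
    using assms by (simp flip: diff_divide_distrib)
  also have "(y - x) / R \<le> (y - x) / 1" using assms by (intro divide_left_mono) auto
  also have "(y - x) / 1 \<le> R * (y - x)" using assms by (simp add: mult_left_le mult_le_cancel_right1)
  finally show ?thesis using min_mult_inverse_lipschitz[of R x y] assms by linarith
qed

lemma continuous_on_slice_length:
  assumes "R \<ge> 1" "A \<subseteq> {0..}"
  shows "continuous_on A (slice_length R)"
proof (rule lipschitz_on_continuous_on)
  show "(2 * R)-lipschitz_on A (slice_length R)"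
  proof (rule lipschitz_onI)
    fix x y assume xy: "x \<in> A" "y \<in> A"
    show "dist (slice_length R x) (slice_length R y) \<le> 2 * R * dist x y"
      using slice_length_lipschitz[of R x y] slice_length_lipschitz[of R y x] assms xy
      by (cases "x \<le> y") (auto simp: dist_real_def abs_minus_commute)
  qed (use assms in auto)
qed

lemma slice_length_integrable:
  assumes "R \<ge> 1" "0 \<le> a"
  shows "slice_length R integrable_on {a..b}"
  using assms by (intro integrable_continuous_real continuous_on_slice_length) auto

text \<open>This is the area behind the main term. The right end of the slice changes from
  \<open>y * R\<close> to \<open>1 / y\<close> at \<open>1 / sqrt R\<close>, and the slice has
  length 0 from \<open>sqrt R\<close> on. The quadratic terms of the first two pieces cancel, and
  the logarithm at each of the two break points contributes half of \<open>ln R\<close>.\<close>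

lemma slice_length_has_integral:
  assumes R: "R \<ge> 1" and Y: "sqrt R \<le> Y"
  shows "(slice_length R has_integral ln R) {0..Y}"
proof -
  define s where "s = 1 / sqrt R"
  have sq: "sqrt R \<ge> 1" using R by simp
  have RR: "sqrt R * sqrt R = R" using R by simp
  have s: "0 < s" "s \<le> sqrt R" using sq RR by (auto simp: s_def field_simps)
  have ss: "s * s * R = 1" unfolding s_def using R RR by (simp add: field_simps)
  have "((\<lambda>y. (R - 1 / R) * y) has_integral (R - 1 / R) * s\<^sup>2 / 2 - (R - 1 / R) * 0\<^sup>2 / 2) {0..s}"
    using s by (intro fundamental_theorem_of_calculus)
      (auto intro!: derivative_eq_intros simp flip: has_real_derivative_iff_has_vector_derivative)
  moreover have "slice_length R y = (R - 1 / R) * y" if "y \<in> {0..s}" for y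
  proof (cases "y = 0")
    case False
    then have y: "y > 0" using that by auto
    have "y * y * R \<le> s * s * R" using that y R by (intro mult_right_mono mult_mono) auto
    then have "y * R \<le> 1 / y" using y ss by (simp add: field_simps)
    moreover have "1 / R \<le> R" using R by (simp add: field_simps mult_ge1_I)
    then have "y * (1 / R) \<le> y * R" using y by (intro mult_left_mono) auto
    ultimately show ?thesis by (simp add: slice_length_def algebra_simps)
  qed (simp add: slice_length_def)
  ultimately have 1: "(slice_length R has_integral (R - 1 / R) * s\<^sup>2 / 2) {0..s}"
    by (subst has_integral_cong[where g = "\<lambda>y. (R - 1 / R) * y"]) auto
  have "((\<lambda>y. 1 / y - y / R) has_integral
         (ln (sqrt R) - (sqrt R)\<^sup>2 / (2 * R)) - (ln s - s\<^sup>2 / (2 * R))) {s..sqrt R}"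
    using s R by (intro fundamental_theorem_of_calculus)
      (auto intro!: derivative_eq_intros simp: field_simps
         simp flip: has_real_derivative_iff_has_vector_derivative)
  moreover have "slice_length R y = 1 / y - y / R" if "y \<in> {s..sqrt R}" for y
  proof -
    have y: "y > 0" using that s by auto
    have "s * s * R \<le> y * y * R" using that s R by (intro mult_right_mono mult_mono) auto
    then have "1 / y \<le> y * R" using y ss by (simp add: field_simps)
    moreover have "y * y \<le> sqrt R * sqrt R" using that y sq by (intro mult_mono) auto
    then have "y / R \<le> 1 / y" using y R by (simp add: field_simps)
    ultimately show ?thesis by (simp add: slice_length_def)
  qed
  ultimately have 2: "(slice_length R has_integral
         (ln (sqrt R) - (sqrt R)\<^sup>2 / (2 * R)) - (ln s - s\<^sup>2 / (2 * R))) {s..sqrt R}"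
    by (subst has_integral_cong[where g = "\<lambda>y. 1 / y - y / R"]) auto
  have "slice_length R y = 0" if "y \<in> {sqrt R..Y}" for y
  proof -
    have "sqrt R \<le> y" using that by simp
    then have y: "y > 0" using sq by linarith
    have "sqrt R * sqrt R \<le> y * y" using \<open>sqrt R \<le> y\<close> y by (intro mult_mono) (use R in auto)
    then have "1 / y \<le> y / R" using y R by (simp add: field_simps)
    then show ?thesis by (simp add: slice_length_def)
  qed
  then have 3: "(slice_length R has_integral 0) {sqrt R..Y}"
    by (subst has_integral_cong[where g = "\<lambda>y. 0"]) auto
  define v where "v = (R - 1 / R) * s\<^sup>2 / 2
    + ((ln (sqrt R) - (sqrt R)\<^sup>2 / (2 * R)) - (ln s - s\<^sup>2 / (2 * R))) + 0"
  have "(slice_length R has_integral v) {0..Y}"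
    unfolding v_def using 1 2 3 s Y by (meson has_integral_combine order_trans less_imp_le)
  moreover have "v = ln R"
  proof -
    have "s\<^sup>2 = 1 / R" using ss R by (simp add: field_simps power2_eq_square)
    moreover have "ln s = - (ln R / 2)" using R by (simp add: s_def ln_div ln_sqrt)
    moreover have "ln (sqrt R) = ln R / 2" using R by (simp add: ln_sqrt)
    moreover have "(sqrt R)\<^sup>2 = R" using R by simp
    ultimately have "v = (R - 1 / R) * (1 / R) / 2 + ((ln R / 2 - R / (2 * R)) - (- (ln R / 2) - 1 / R / (2 * R)))"
      by (simp add: v_def)
    also have "\<dots> = ln R" using R by (simp add: field_simps)
    finally show ?thesis .
  qed
  ultimately show ?thesis by simp
qed

text \<open>Left rectangle rule: on an interval of length y - x the Lipschitz bound keeps the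
  integrand within 2 R (y - x) of its left value.\<close>

lemma slice_length_integral_approx:
  assumes R: "R \<ge> 1" and xy: "0 \<le> x" "x \<le> y"
  shows "\<bar>(y - x) * slice_length R x - integral {x..y} (slice_length R)\<bar> \<le> 2 * R * (y - x)\<^sup>2"
proof -
  have "((\<lambda>t. slice_length R x - slice_length R t) has_integral
          ((y - x) * slice_length R x - integral {x..y} (slice_length R))) {x..y}"
    using slice_length_integrable[of R x y] has_integral_const_real[of "slice_length R x" x y] assms
    by (intro has_integral_diff) (auto intro: integrable_integral)
  moreover have "norm (slice_length R x - slice_length R t) \<le> 2 * R * (y - x)" if "t \<in> {x..y}" for t
  proof -
    have "\<bar>slice_length R t - slice_length R x\<bar> \<le> 2 * R * (t - x)"
      using that assms by (intro slice_length_lipschitz) auto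
    also have "\<dots> \<le> 2 * R * (y - x)" using that R by (intro mult_left_mono) auto
    finally show ?thesis by (simp add: abs_minus_commute)
  qed
  ultimately have "norm ((y - x) * slice_length R x - integral {x..y} (slice_length R))
      \<le> 2 * R * (y - x) * measure lborel {x..y}"
    using assms by (intro has_integral_bound_real[where f = "\<lambda>t. slice_length R x - slice_length R t"]) auto
  then show ?thesis using xy by (simp add: power2_eq_square)
qed

lemma slice_length_riemann_sum:
  assumes R: "R \<ge> 1" and x: "0 \<le> x" and d: "0 \<le> d"
  shows "\<bar>(\<Sum>j<J. d * slice_length R (x + d * real j)) - integral {x..x + d * real J} (slice_length R)\<bar>
     \<le> real J * (2 * R * d\<^sup>2)"
proof (induction J)
  case (Suc J)
  let ?y = "x + d * real J"
  have "integral {x..?y} (slice_length R) + integral {?y..?y + d} (slice_length R)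
      = integral {x..?y + d} (slice_length R)"
    using assms by (intro Henstock_Kurzweil_Integration.integral_combine slice_length_integrable) auto
  moreover have "\<bar>d * slice_length R ?y - integral {?y..?y + d} (slice_length R)\<bar> \<le> 2 * R * d\<^sup>2"
    using slice_length_integral_approx[of R ?y "?y + d"] assms by simp
  moreover have "x + d * real (Suc J) = ?y + d" by (simp add: algebra_simps)
  ultimately show ?case using Suc.IH by (simp add: algebra_simps)
qed simp

section \<open>Lattice points of the region in one residue class\<close>

text \<open>The members of the class are \<alpha> + m j for the integers j between \<open>u\<close>
  and \<open>v\<close>. There are floor v - ceiling u + 1 of them, which is within 1 of v -
  u.\<close>

lemma card_residue_class_interval:
  fixes x y :: real
  assumes m: "m > 0" and al: "\<alpha> < m" and x: "x \<ge> 0"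
  shows "\<bar>real (card {a::nat. a mod m = \<alpha> \<and> x \<le> real a \<and> real a \<le> y}) - max 0 (y - x) / real m\<bar> \<le> 1"
proof (cases "x \<le> y")
  case False
  then have "{a::nat. a mod m = \<alpha> \<and> x \<le> real a \<and> real a \<le> y} = {}" by auto
  then show ?thesis using False by (simp only: card.empty)
next
  case True
  define u where "u = (x - real \<alpha>) / real m"
  define v where "v = (y - real \<alpha>) / real m"
  have uv: "v - u = (y - x) / real m" by (simp add: u_def v_def flip: diff_divide_distrib)
  have "u \<le> v" using True m by (simp add: u_def v_def divide_right_mono)
  have "real \<alpha> < real m" using al by simp
  then have "x - real \<alpha> > - real m" using x by linarith
  \<comment> \<open>The ceiling of \<open>u\<close> is therefore nonnegative, so every integer index
    in the range comes from a natural number.\<close>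
  then have u1: "u > -1" using m by (simp add: u_def field_simps)
  have "bij_betw (\<lambda>j. nat (int \<alpha> + int m * j)) {\<lceil>u\<rceil>..\<lfloor>v\<rfloor>}
          {a::nat. a mod m = \<alpha> \<and> x \<le> real a \<and> real a \<le> y}"
  proof (rule bij_betwI[where g = "\<lambda>a. int (a div m)"])
    have *: "j \<ge> 0" if "\<lceil>u\<rceil> \<le> j" for j using that u1 by linarith
    show "(\<lambda>j. nat (int \<alpha> + int m * j)) \<in> {\<lceil>u\<rceil>..\<lfloor>v\<rfloor>} \<rightarrow>
            {a::nat. a mod m = \<alpha> \<and> x \<le> real a \<and> real a \<le> y}"
    proof
      fix j assume j: "j \<in> {\<lceil>u\<rceil>..\<lfloor>v\<rfloor>}"
      then obtain k where k: "j = int k" using *[of j] by (auto elim: nonneg_int_cases)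
      have "u \<le> real k" "real k \<le> v" using j k by (auto simp: ceiling_le_iff le_floor_iff)
      then have "x \<le> real (\<alpha> + m * k)" "real (\<alpha> + m * k) \<le> y"
        using m by (auto simp: u_def v_def field_simps)
      moreover have "nat (int \<alpha> + int m * j) = \<alpha> + m * k"
        unfolding k by (metis nat_int of_nat_add of_nat_mult)
      ultimately show "nat (int \<alpha> + int m * j) \<in> {a::nat. a mod m = \<alpha> \<and> x \<le> real a \<and> real a \<le> y}"
        using al by simp
    qed
    show "(\<lambda>a. int (a div m)) \<in> {a::nat. a mod m = \<alpha> \<and> x \<le> real a \<and> real a \<le> y} \<rightarrow> {\<lceil>u\<rceil>..\<lfloor>v\<rfloor>}"
    proof
      fix a :: nat assume a: "a \<in> {a. a mod m = \<alpha> \<and> x \<le> real a \<and> real a \<le> y}"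
      have "real a = real m * real (a div m) + real \<alpha>"
        using a by (metis (mono_tags) mem_Collect_eq mult_div_mod_eq of_nat_add of_nat_mult)
      then have "u \<le> real (a div m)" "real (a div m) \<le> v"
        using a m by (auto simp: u_def v_def field_simps)
      then show "int (a div m) \<in> {\<lceil>u\<rceil>..\<lfloor>v\<rfloor>}"
        by (simp add: ceiling_le_iff le_floor_iff)
    qed
    show "int (nat (int \<alpha> + int m * j) div m) = j" if j: "j \<in> {\<lceil>u\<rceil>..\<lfloor>v\<rfloor>}" for j
    proof -
      obtain k where k: "j = int k" using *[of j] j by (auto elim: nonneg_int_cases)
      have "nat (int \<alpha> + int m * j) = \<alpha> + m * k"
        unfolding k by (metis nat_int of_nat_add of_nat_mult)
      then show ?thesis using m al k by simp
    qed
    show "nat (int \<alpha> + int m * int (a div m)) = a"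
      if "a \<in> {a. a mod m = \<alpha> \<and> x \<le> real a \<and> real a \<le> y}" for a
    proof -
      have "a = \<alpha> + m * (a div m)" using that by auto
      then have "int a = int \<alpha> + int m * int (a div m)" by (metis of_nat_add of_nat_mult)
      then show ?thesis by simp
    qed
  qed
  then have "card {a::nat. a mod m = \<alpha> \<and> x \<le> real a \<and> real a \<le> y} = nat (\<lfloor>v\<rfloor> - \<lceil>u\<rceil> + 1)"
    by (auto dest: bij_betw_same_card)
  \<comment> \<open>Equality means that no integer lies between \<open>u\<close> and
    \<open>v\<close>; the bound ensures that \<open>nat\<close> does not truncate the count.\<close>
  moreover have "\<lceil>u\<rceil> \<le> \<lfloor>v\<rfloor> + 1" using \<open>u \<le> v\<close> by linarith
  ultimately have "real (card {a::nat. a mod m = \<alpha> \<and> x \<le> real a \<and> real a \<le> y})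
      = real_of_int \<lfloor>v\<rfloor> - real_of_int \<lceil>u\<rceil> + 1" by simp
  moreover have "max 0 (y - x) / real m = v - u" using True uv by simp
  ultimately show ?thesis by linarith
qed

text \<open>The ratio bounds are multiplied out to avoid division; positivity of the first
  coordinate then follows from 1 <= b <= R a.\<close>

definition hyp_region :: "real \<Rightarrow> real \<Rightarrow> (nat \<times> nat) set" where
  "hyp_region N R = {(a, b). b \<ge> 1 \<and> real a * real b \<le> N \<and> real b \<le> R * real a \<and> real a \<le> R * real b}"

text \<open>Multiplying a <= R b by a gives a^2 <= R a b <= R N, and symmetrically for b. This box
  limits both the number of rows and the primes that occur in the sieve tail.\<close>

lemma hyp_region_bounds:
  assumes "(a, b) \<in> hyp_region N R" "R \<ge> 1"
  shows "1 \<le> a" "1 \<le> b" "real a \<le> sqrt (R * N)" "real b \<le> sqrt (R * N)"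
proof -
  from assms have *: "b \<ge> 1" "real a * real b \<le> N" "real b \<le> R * real a" "real a \<le> R * real b"
    by (auto simp: hyp_region_def)
  show "1 \<le> b" by fact
  show "1 \<le> a" using * by (cases a) auto
  have "real b * real b \<le> R * real a * real b" using * by (intro mult_right_mono) auto
  also have "\<dots> \<le> R * N" using * assms by (simp add: mult.assoc mult_left_mono)
  finally show "real b \<le> sqrt (R * N)" by (intro real_le_rsqrt) (simp add: power2_eq_square)
  have "real a * real a \<le> R * real b * real a" using * by (intro mult_right_mono) auto
  also have "\<dots> \<le> R * N" using * assms by (simp add: mult.assoc mult_left_mono mult.commute[of "real b"])
  finally show "real a \<le> sqrt (R * N)" by (intro real_le_rsqrt) (simp add: power2_eq_square)
qed

lemma hyp_region_subset:
  assumes "R \<ge> 1"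
  shows "hyp_region N R \<subseteq> {1..nat \<lfloor>sqrt (R * N)\<rfloor>} \<times> {1..nat \<lfloor>sqrt (R * N)\<rfloor>}"
  using hyp_region_bounds[OF _ assms, of _ _ N] by (auto simp: le_nat_floor)

lemma finite_hyp_region:
  assumes "R \<ge> 1"
  shows "finite (hyp_region N R)"
  using hyp_region_subset[OF assms] by (rule finite_subset) simp

text \<open>The row at height \<open>b\<close> is an interval from b / R to min (b R, N / b), which
  is \<open>sqrt N\<close> times the slice of the scaled region at height b / sqrt N.\<close>

lemma card_slice:
  assumes R: "R \<ge> 1" and m: "m > 0" and al: "\<alpha> < m" and N: "N > 0"
  shows "\<bar>real (card {a. a mod m = \<alpha> \<and> (a, b) \<in> hyp_region N R})
      - sqrt N * slice_length R (real b / sqrt N) / real m\<bar> \<le> 1"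
proof (cases "b = 0")
  case True
  then show ?thesis by (simp add: hyp_region_def slice_length_def)
next
  case False
  have sN: "sqrt N * sqrt N = N" using N by simp
  have "{a. a mod m = \<alpha> \<and> (a, b) \<in> hyp_region N R}
      = {a. a mod m = \<alpha> \<and> real b / R \<le> real a \<and> real a \<le> min (real b * R) (N / real b)}"
    using False R by (auto simp: hyp_region_def field_simps)
  moreover have "sqrt N * slice_length R (real b / sqrt N) = max 0 (min (real b * R) (N / real b) - real b / R)"
  proof -
    have c: "sqrt N * max 0 z = max 0 (sqrt N * z)" "sqrt N * min w z = min (sqrt N * w) (sqrt N * z)" for w z
      using N by (auto simp: max_def min_def mult_le_0_iff zero_le_mult_iff)
    show ?thesis using N False sN
      by (simp add: slice_length_def c right_diff_distrib)
  qed
  ultimately show ?thesis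
    using card_residue_class_interval[OF m al, of "real b / R" "min (real b * R) (N / real b)"] R
    by simp
qed

text \<open>The rows are b = \<beta> + m j with j < J. Each row contributes an error of at most 1,
  and J is of order sqrt N. The row lengths form a Riemann sum with step m / sqrt N starting at
  \<beta> / sqrt N; its quadrature error has order J d^2, and the piece of the integral before the
  start has order 1 / N.\<close>

lemma card_hyp_region_residue_error:
  assumes R: "R \<ge> 1" and al: "\<alpha> < m" and be: "\<beta> < m" and N: "N > 0"
  shows "\<bar>real (card {(a, b) \<in> hyp_region N R. a mod m = \<alpha> \<and> b mod m = \<beta>}) / N - ln R / (real m)\<^sup>2\<bar>
     \<le> ((sqrt R / real m) * (1 + 2 * R) * sqrt N + (1 + 2 * R + 2 * R * (real \<beta> / real m)\<^sup>2)) / N"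
proof -
  have m: "m > 0" using al by simp
  define s where "s = sqrt N"
  have s: "s > 0" and ss: "s * s = N" using N by (auto simp: s_def)
  \<comment> \<open>The added 1 makes \<open>m * J\<close> exceed \<open>sqrt (R * N)\<close>, so
    the indices below \<open>J\<close> reach every nonempty row and the Riemann sum runs past
    \<open>sqrt R\<close>.\<close>
  define J where "J = nat \<lfloor>sqrt (R * N) / real m\<rfloor> + 1"
  define d where "d = real m / s"
  have d: "d > 0" using s m by (simp add: d_def)
  have J1: "sqrt (R * N) / real m < real J" and J2: "real J \<le> sqrt (R * N) / real m + 1"
    using R N by (simp_all add: J_def) linarith+
  have J3: "sqrt (R * N) < real m * real J" using J1 m by (simp add: field_simps)
  define c where "c b = card {a. a mod m = \<alpha> \<and> (a, b) \<in> hyp_region N R}" for b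
  let ?A = "{(a, b) \<in> hyp_region N R. a mod m = \<alpha> \<and> b mod m = \<beta>}"
  \<comment> \<open>The coordinates are swapped so that the dependent sum is indexed by the row
    \<open>b\<close>.\<close>
  have "?A = prod.swap ` (SIGMA b:(\<lambda>j. \<beta> + m * j) ` {..<J}. {a. a mod m = \<alpha> \<and> (a, b) \<in> hyp_region N R})"
    (is "_ = _ ` ?B")
  proof (intro equalityI subsetI)
    fix z assume "z \<in> ?A"
    then obtain a b where z: "z = (a, b)" and ab: "(a, b) \<in> hyp_region N R" "a mod m = \<alpha>" "b mod m = \<beta>"
      by auto
    have b: "b = \<beta> + m * (b div m)" using ab by (metis add.commute mult_div_mod_eq)
    have "real m * real (b div m) \<le> real b" by (metis le_add2 b of_nat_le_iff of_nat_mult)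
    also have "\<dots> \<le> sqrt (R * N)" using hyp_region_bounds[OF ab(1) R] by simp
    finally have "real m * real (b div m) < real m * real J" using J3 by simp
    then have "b div m < J" using m by (simp add: mult_less_cancel_left)
    then have "(b, a) \<in> ?B" using b ab by blast
    then have "prod.swap (b, a) \<in> prod.swap ` ?B" by (rule imageI)
    then show "z \<in> prod.swap ` ?B" unfolding z by simp
  next
    fix z assume "z \<in> prod.swap ` ?B"
    then show "z \<in> ?A" using be by auto
  qed
  have fin: "finite {a. a mod m = \<alpha> \<and> (a, b) \<in> hyp_region N R}" for b
    by (rule finite_subset[OF _ finite_imageI[OF finite_hyp_region[OF R, of N], of fst]]) force
  have "card ?A = card ?B" unfolding \<open>?A = _\<close> by (simp add: card_image)
  also have "\<dots> = (\<Sum>b\<in>(\<lambda>j. \<beta> + m * j) ` {..<J}. c b)"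
    unfolding c_def
    by (rule card_SigmaI) (use fin in auto)
  also have "\<dots> = (\<Sum>j<J. c (\<beta> + m * j))"
    using m by (subst sum.reindex) (auto simp: inj_on_def)
  finally have cA: "real (card ?A) = (\<Sum>j<J. real (c (\<beta> + m * j)))" by simp
  define x where "x = real \<beta> / s"
  have x: "x \<ge> 0" using s by (simp add: x_def)
  have xd: "real (\<beta> + m * j) / s = x + d * real j" for j
    by (simp add: x_def d_def add_divide_distrib)
  define T where "T = (\<Sum>j<J. d * slice_length R (x + d * real j))"
  have "\<bar>(\<Sum>j<J. real (c (\<beta> + m * j))) - (\<Sum>j<J. s * slice_length R (x + d * real j) / real m)\<bar>
      \<le> (\<Sum>j<J. \<bar>real (c (\<beta> + m * j)) - s * slice_length R (x + d * real j) / real m\<bar>)"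
    unfolding sum_subtractf[symmetric] by (rule sum_abs)
  also have "\<dots> \<le> (\<Sum>j<J. 1)"
    using card_slice[OF R m al N, of "\<beta> + m * _", folded s_def]
    by (intro sum_mono) (simp add: c_def xd del: of_nat_add of_nat_mult)
  also have "(\<Sum>j<J. s * slice_length R (x + d * real j) / real m) = N / (real m)\<^sup>2 * T"
    unfolding T_def sum_distrib_left using s m
    by (intro sum.cong) (auto simp: d_def ss[symmetric] field_simps power2_eq_square)
  finally have e1: "\<bar>real (card ?A) - N / (real m)\<^sup>2 * T\<bar> \<le> real J" using cA by simp
  have "sqrt R * s \<le> real m * real J" using J3 by (simp add: s_def real_sqrt_mult)
  then have "sqrt R \<le> d * real J" using s by (simp add: d_def field_simps)
  then have Y: "sqrt R \<le> x + d * real J" using x by simp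
  have "integral {0..x} (slice_length R) + integral {x..x + d * real J} (slice_length R)
      = integral {0..x + d * real J} (slice_length R)"
    using R x d by (intro Henstock_Kurzweil_Integration.integral_combine slice_length_integrable) auto
  also have "\<dots> = ln R" using slice_length_has_integral[OF R Y] by (rule integral_unique)
  finally have e2: "integral {x..x + d * real J} (slice_length R) = ln R - integral {0..x} (slice_length R)"
    by simp
  \<comment> \<open>The slice length vanishes at 0, so the rectangle over this missing initial piece
    is 0 and the rectangle rule bounds the integral itself.\<close>
  have "\<bar>integral {0..x} (slice_length R)\<bar> \<le> 2 * R * x\<^sup>2"
    using slice_length_integral_approx[OF R, of 0 x] x by (simp add: slice_length_def)
  then have e3: "\<bar>T - ln R\<bar> \<le> real J * (2 * R * d\<^sup>2) + 2 * R * x\<^sup>2"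
    using slice_length_riemann_sum[OF R x, of d J] d e2 unfolding T_def by linarith
  have "real (card ?A) / N - ln R / (real m)\<^sup>2
      = (real (card ?A) - N / (real m)\<^sup>2 * T) / N + (T - ln R) / (real m)\<^sup>2"
    using N m by (simp add: field_simps)
  also have "\<bar>\<dots>\<bar> \<le> \<bar>(real (card ?A) - N / (real m)\<^sup>2 * T) / N\<bar> + \<bar>(T - ln R) / (real m)\<^sup>2\<bar>"
    by (rule abs_triangle_ineq)
  also have "\<dots> = \<bar>real (card ?A) - N / (real m)\<^sup>2 * T\<bar> / N + \<bar>T - ln R\<bar> / (real m)\<^sup>2"
    using N by simp
  also have "\<dots> \<le> real J / N + (real J * (2 * R * d\<^sup>2) + 2 * R * x\<^sup>2) / (real m)\<^sup>2"
    using e1 e3 N by (intro add_mono divide_right_mono) auto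
  \<comment> \<open>By the choice of \<open>d\<close> and \<open>x\<close>, (d / m)^2 = 1 / N and (x
    / m)^2 = (\<beta> / m)^2 / N.\<close>
  also have "\<dots> = (real J * (1 + 2 * R) + 2 * R * (real \<beta> / real m)\<^sup>2) / N"
    using N m s by (simp add: d_def x_def ss[symmetric] field_simps power2_eq_square)
  also have "\<dots> \<le> ((sqrt (R * N) / real m + 1) * (1 + 2 * R) + 2 * R * (real \<beta> / real m)\<^sup>2) / N"
    using N R J2 by (intro divide_right_mono add_mono mult_right_mono) auto
  finally show ?thesis by (simp add: real_sqrt_mult algebra_simps add_divide_distrib)
qed

lemma card_hyp_region_residue_tendsto:
  assumes R: "R \<ge> 1" and al: "\<alpha> < m" and be: "\<beta> < m"
  shows "((\<lambda>N. real (card {(a, b) \<in> hyp_region N R. a mod m = \<alpha> \<and> b mod m = \<beta>}) / N)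
      \<longlongrightarrow> ln R / (real m)\<^sup>2) at_top"
proof -
  have "((\<lambda>N. (A * sqrt N + B) / N) \<longlongrightarrow> 0) at_top" for A B :: real
    by real_asymp
  then have "((\<lambda>N. ((sqrt R / real m) * (1 + 2 * R) * sqrt N
       + (1 + 2 * R + 2 * R * (real \<beta> / real m)\<^sup>2)) / N) \<longlongrightarrow> 0) at_top" .
  moreover have "eventually (\<lambda>N. norm (real (card {(a, b) \<in> hyp_region N R. a mod m = \<alpha> \<and> b mod m = \<beta>}) / N
       - ln R / (real m)\<^sup>2) \<le> ((sqrt R / real m) * (1 + 2 * R) * sqrt N
       + (1 + 2 * R + 2 * R * (real \<beta> / real m)\<^sup>2)) / N) at_top"
    using eventually_gt_at_top[of 0]
    by eventually_elim (use card_hyp_region_residue_error[OF R al be] in simp)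
  ultimately have "((\<lambda>N. real (card {(a, b) \<in> hyp_region N R. a mod m = \<alpha> \<and> b mod m = \<beta>}) / N
       - ln R / (real m)\<^sup>2) \<longlongrightarrow> 0) at_top"
    by (rule Lim_null_comparison[rotated])
  then show ?thesis by (simp add: LIM_zero_iff)
qed


section \<open>Periodic conditions and the Chinese remainder theorem\<close>

definition periodic2 :: "nat \<Rightarrow> (nat \<Rightarrow> nat \<Rightarrow> bool) \<Rightarrow> bool" where
  "periodic2 m P \<longleftrightarrow> (\<forall>a b. P (a mod m) (b mod m) = P a b)"

definition residue_pairs :: "nat \<Rightarrow> (nat \<Rightarrow> nat \<Rightarrow> bool) \<Rightarrow> (nat \<times> nat) set" where
  "residue_pairs m P = {(a, b). a < m \<and> b < m \<and> P a b}"

lemma finite_residue_pairs [simp]: "finite (residue_pairs m P)"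
  by (rule finite_subset[of _ "{..<m} \<times> {..<m}"]) (auto simp: residue_pairs_def)

text \<open>Periodicity splits the set into finitely many residue classes, one for each admissible
  pair, and all of them have the same limit share.\<close>

lemma card_hyp_region_periodic_tendsto:
  assumes R: "R \<ge> 1" and m: "m > 0" and P: "periodic2 m P"
  shows "((\<lambda>N. real (card {(a, b) \<in> hyp_region N R. P a b}) / N)
      \<longlongrightarrow> ln R * (real (card (residue_pairs m P)) / (real m)\<^sup>2)) at_top"
proof -
  let ?f = "\<lambda>N (\<alpha>, \<beta>). real (card {(a, b) \<in> hyp_region N R. a mod m = \<alpha> \<and> b mod m = \<beta>})"
  have "real (card {(a, b) \<in> hyp_region N R. P a b}) / N = (\<Sum>z\<in>residue_pairs m P. ?f N z / N)" for N
  proof -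
    let ?A = "{(a, b) \<in> hyp_region N R. P a b}"
    let ?g = "\<lambda>(a, b). (a mod m, b mod m)"
    have fin: "finite ?A" by (rule finite_subset[OF _ finite_hyp_region[OF R, of N]]) auto
    have "(\<Sum>z\<in>residue_pairs m P. \<Sum>x\<in>{x \<in> ?A. ?g x = z}. 1) = (\<Sum>x\<in>?A. (1::real))"
      by (rule sum.group[OF fin finite_residue_pairs])
        (use m P in \<open>auto simp: residue_pairs_def periodic2_def\<close>)
    moreover have "(\<Sum>x\<in>{x \<in> ?A. ?g x = z}. 1) = ?f N z" if "z \<in> residue_pairs m P" for z
    proof -
      obtain \<alpha> \<beta> where z: "z = (\<alpha>, \<beta>)" by fastforce
      have "P a b" if "a mod m = \<alpha>" "b mod m = \<beta>" for a b
        using that P \<open>z \<in> _\<close> unfolding z residue_pairs_def periodic2_def by auto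
      then have "{x \<in> ?A. ?g x = z} = {(a, b) \<in> hyp_region N R. a mod m = \<alpha> \<and> b mod m = \<beta>}"
        unfolding z by auto
      then show ?thesis by (simp add: z)
    qed
    ultimately show ?thesis by (simp add: sum_divide_distrib[symmetric])
  qed
  moreover have "((\<lambda>N. \<Sum>z\<in>residue_pairs m P. ?f N z / N)
      \<longlongrightarrow> (\<Sum>z\<in>residue_pairs m P. ln R / (real m)\<^sup>2)) at_top"
    using card_hyp_region_residue_tendsto[OF R]
    by (intro tendsto_sum) (auto simp: residue_pairs_def)
  ultimately show ?thesis by (simp add: mult.commute)
qed

text \<open>Surjectivity follows from injectivity and equality of the finite cardinalities, so no
  simultaneous solution has to be constructed.\<close>

lemma bij_betw_chinese_remainder:
  fixes m n :: nat
  assumes mn: "coprime m n" and pos: "m > 0" "n > 0"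
  shows "bij_betw (\<lambda>x. (x mod m, x mod n)) {..<m * n} ({..<m} \<times> {..<n})"
  unfolding bij_betw_def
proof
  show inj: "inj_on (\<lambda>x. (x mod m, x mod n)) {..<m * n}"
  proof (rule inj_onI)
    fix x y assume "x \<in> {..<m * n}" "y \<in> {..<m * n}" "(x mod m, x mod n) = (y mod m, y mod n)"
    then show "x = y" using coprime_cong_mult_nat[of x y m n] mn by (simp add: cong_def)
  qed
  show "(\<lambda>x. (x mod m, x mod n)) ` {..<m * n} = {..<m} \<times> {..<n}"
    by (rule card_subset_eq) (use pos card_image[OF inj] in auto)
qed

text \<open>The Chinese remainder bijection is applied to each coordinate; periodicity lets
  \<open>P\<close> be read off modulo m and \<open>Q\<close> modulo n.\<close>

lemma card_residue_pairs_mult: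
  assumes mn: "coprime m n" and pos: "m > 0" "n > 0"
    and P: "periodic2 m P" and Q: "periodic2 n Q"
  shows "card (residue_pairs (m * n) (\<lambda>a b. P a b \<and> Q a b))
    = card (residue_pairs m P) * card (residue_pairs n Q)"
proof -
  let ?c = "\<lambda>x. (x mod m, x mod n)"
  let ?f = "\<lambda>(a, b). ((a mod m, b mod m), (a mod n, b mod n))"
  note bij = bij_betw_chinese_remainder[OF mn pos]
  have "bij_betw ?f (residue_pairs (m * n) (\<lambda>a b. P a b \<and> Q a b)) (residue_pairs m P \<times> residue_pairs n Q)"
    unfolding bij_betw_def
  proof
    show "inj_on ?f (residue_pairs (m * n) (\<lambda>a b. P a b \<and> Q a b))"
    proof (rule inj_onI, clarify)
      fix a b a' b'
      assume "(a, b) \<in> residue_pairs (m * n) (\<lambda>a b. P a b \<and> Q a b)"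
        "(a', b') \<in> residue_pairs (m * n) (\<lambda>a b. P a b \<and> Q a b)"
        "a mod m = a' mod m" "b mod m = b' mod m" "a mod n = a' mod n" "b mod n = b' mod n"
      then show "a = a' \<and> b = b'"
        using inj_onD[OF bij_betw_imp_inj_on[OF bij], of a a'] inj_onD[OF bij_betw_imp_inj_on[OF bij], of b b']
        by (simp add: residue_pairs_def)
    qed
    show "?f ` residue_pairs (m * n) (\<lambda>a b. P a b \<and> Q a b) = residue_pairs m P \<times> residue_pairs n Q"
    proof (intro equalityI subsetI)
      fix w assume w: "w \<in> residue_pairs m P \<times> residue_pairs n Q"
      then obtain a b a' b' where w': "w = ((a, b), (a', b'))" by (metis surj_pair)
      \<comment> \<open>The entries are regrouped: \<open>a\<close> and \<open>a'\<close> are to be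
        the residues of one number, \<open>b\<close> and \<open>b'\<close> those of another.\<close>
      have "(a, a') \<in> {..<m} \<times> {..<n}" "(b, b') \<in> {..<m} \<times> {..<n}"
        using w by (auto simp: w' residue_pairs_def)
      then obtain x y where x: "x < m * n" "(a, a') = ?c x" and y: "y < m * n" "(b, b') = ?c y"
        unfolding bij_betw_imp_surj_on[OF bij, symmetric] by blast
      have "(x, y) \<in> residue_pairs (m * n) (\<lambda>a b. P a b \<and> Q a b)"
        using w x y P Q by (auto simp: w' residue_pairs_def periodic2_def)
      then have "?f (x, y) \<in> ?f ` residue_pairs (m * n) (\<lambda>a b. P a b \<and> Q a b)" by (rule imageI)
      then show "w \<in> ?f ` residue_pairs (m * n) (\<lambda>a b. P a b \<and> Q a b)"
        using x y by (simp add: w')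
    qed (use pos P Q in \<open>auto simp: residue_pairs_def periodic2_def\<close>)
  qed
  then show ?thesis by (simp add: bij_betw_same_card card_cartesian_product)
qed

lemma periodic2_conj:
  assumes "periodic2 m P" "periodic2 n Q"
  shows "periodic2 (m * n) (\<lambda>a b. P a b \<and> Q a b)"
proof -
  have "P (a mod (m * n)) (b mod (m * n)) = P a b" for a b
    using assms(1)[unfolded periodic2_def, rule_format, of "a mod (m * n)" "b mod (m * n)"]
      assms(1)[unfolded periodic2_def, rule_format, of a b] by (simp add: mod_mod_cancel)
  moreover have "Q (a mod (m * n)) (b mod (m * n)) = Q a b" for a b
    using assms(2)[unfolded periodic2_def, rule_format, of "a mod (m * n)" "b mod (m * n)"]
      assms(2)[unfolded periodic2_def, rule_format, of a b]
    by (simp add: mod_mod_cancel mult.commute[of m])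
  ultimately show ?thesis by (simp add: periodic2_def)
qed

section \<open>The sieve by the primes up to a bound\<close>

definition sieve_modulus :: "nat \<Rightarrow> nat" where
  "sieve_modulus z = (\<Prod>p\<le>z. if prime p then p\<^sup>2 else 1)"

lemma sieve_modulus_Suc:
  "sieve_modulus (Suc z) = sieve_modulus z * (if prime (Suc z) then (Suc z)\<^sup>2 else 1)"
  by (simp add: sieve_modulus_def)

lemma sieve_modulus_pos: "sieve_modulus z > 0"
  unfolding sieve_modulus_def by (intro prod_pos) (auto simp: prime_gt_0_nat)

lemma coprime_sieve_modulus:
  assumes "prime q" "z < q"
  shows "coprime (sieve_modulus z) (q\<^sup>2)"
  unfolding sieve_modulus_def using assms
  by (intro prod_coprime_left) (auto simp: primes_coprime)

text \<open>There are p^4 pairs modulo p^2, whence the denominators. Periodicity and density are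
  proved in one induction because multiplicativity at the next prime uses the periodicity of the
  conditions collected so far.\<close>

lemma sieve_density:
  fixes Q :: "nat \<Rightarrow> nat \<Rightarrow> nat \<Rightarrow> bool"
  assumes Q: "\<And>p. prime p \<Longrightarrow> periodic2 (p\<^sup>2) (Q p)"
  shows "periodic2 (sieve_modulus z) (\<lambda>a b. \<forall>p\<le>z. prime p \<longrightarrow> Q p a b) \<and>
    real (card (residue_pairs (sieve_modulus z) (\<lambda>a b. \<forall>p\<le>z. prime p \<longrightarrow> Q p a b)))
      / (real (sieve_modulus z))\<^sup>2
    = (\<Prod>p\<le>z. if prime p then real (card (residue_pairs (p\<^sup>2) (Q p))) / real p ^ 4 else 1)"
proof (induction z)
  case 0
  have "residue_pairs (Suc 0) (\<lambda>a b. True) = {(0, 0)}" by (auto simp: residue_pairs_def)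
  then show ?case by (auto simp: sieve_modulus_def periodic2_def)
next
  case (Suc z)
  show ?case
  proof (cases "prime (Suc z)")
    case False
    then have "(\<forall>p\<le>Suc z. prime p \<longrightarrow> Q p a b) \<longleftrightarrow> (\<forall>p\<le>z. prime p \<longrightarrow> Q p a b)" for a b
      by (metis le_Suc_eq)
    then show ?thesis using Suc.IH False by (simp add: sieve_modulus_Suc)
  next
    case True
    have *: "(\<forall>p\<le>Suc z. prime p \<longrightarrow> Q p a b) \<longleftrightarrow> (\<forall>p\<le>z. prime p \<longrightarrow> Q p a b) \<and> Q (Suc z) a b" for a b
      using True by (metis le_Suc_eq)
    have M: "sieve_modulus (Suc z) = sieve_modulus z * (Suc z)\<^sup>2" using True by (simp add: sieve_modulus_Suc)
    show ?thesis
      unfolding * M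
    proof
      show "periodic2 (sieve_modulus z * (Suc z)\<^sup>2) (\<lambda>a b. (\<forall>p\<le>z. prime p \<longrightarrow> Q p a b) \<and> Q (Suc z) a b)"
        using Suc.IH Q[OF True] by (intro periodic2_conj) auto
      have "card (residue_pairs (sieve_modulus z * (Suc z)\<^sup>2) (\<lambda>a b. (\<forall>p\<le>z. prime p \<longrightarrow> Q p a b) \<and> Q (Suc z) a b))
        = card (residue_pairs (sieve_modulus z) (\<lambda>a b. \<forall>p\<le>z. prime p \<longrightarrow> Q p a b))
          * card (residue_pairs ((Suc z)\<^sup>2) (Q (Suc z)))"
        using Suc.IH Q[OF True] True
        by (intro card_residue_pairs_mult coprime_sieve_modulus sieve_modulus_pos) auto
      then show "real (card (residue_pairs (sieve_modulus z * (Suc z)\<^sup>2)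
            (\<lambda>a b. (\<forall>p\<le>z. prime p \<longrightarrow> Q p a b) \<and> Q (Suc z) a b))) / (real (sieve_modulus z * (Suc z)\<^sup>2))\<^sup>2
        = (\<Prod>p\<le>Suc z. if prime p then real (card (residue_pairs (p\<^sup>2) (Q p))) / real p ^ 4 else 1)"
        using Suc.IH[THEN conjunct2, symmetric] True
        by (simp add: power_mult_distrib flip: power_mult)
    qed
  qed
qed

section \<open>The contribution of the large primes\<close>

definition carefree_at :: "nat \<Rightarrow> nat \<Rightarrow> nat \<Rightarrow> bool" where
  "carefree_at p a b \<longleftrightarrow> \<not> p\<^sup>2 dvd a \<and> \<not> p\<^sup>2 dvd b \<and> \<not> (p dvd a \<and> p dvd b)"

text \<open>Counting from 1 excludes the multiple 0, which is why no additive constant appears; such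
  a constant would spoil the sum over primes.\<close>

lemma card_multiples_le:
  fixes d X :: nat
  assumes "d > 0"
  shows "real (card {a \<in> {1..X}. d dvd a}) \<le> real X / real d"
proof -
  have "{a \<in> {1..X}. d dvd a} \<subseteq> (\<lambda>k. d * k) ` {1..X div d}"
  proof
    fix a assume a: "a \<in> {a \<in> {1..X}. d dvd a}"
    then obtain k where "a = d * k" by auto
    with a assms show "a \<in> (\<lambda>k. d * k) ` {1..X div d}"
      by (cases "k = 0") (auto simp: less_eq_div_iff_mult_less_eq mult.commute)
  qed
  then have "card {a \<in> {1..X}. d dvd a} \<le> card {1..X div d}"
    by (rule surj_card_le[rotated]) simp
  also have "real (card {1..X div d}) \<le> real X / real d"
    by (simp add: of_nat_div_le_of_nat)
  finally show ?thesis by simp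
qed

text \<open>There are three ways to fail: p^2 divides a, p^2 divides b, or p divides both. Each
  takes at most a fraction 1 / p^2 of the box.\<close>

lemma card_not_carefree_at_le:
  assumes "p > 0"
  shows "real (card {(a, b) \<in> {1..X} \<times> {1..X}. \<not> carefree_at p a b}) \<le> 3 * (real X)\<^sup>2 / (real p)\<^sup>2"
proof -
  let ?M = "\<lambda>d. {a \<in> {1..X}. d dvd a}"
  have "{(a, b) \<in> {1..X} \<times> {1..X}. \<not> carefree_at p a b}
      = ?M (p\<^sup>2) \<times> {1..X} \<union> {1..X} \<times> ?M (p\<^sup>2) \<union> ?M p \<times> ?M p" (is "?B = ?C \<union> ?D \<union> ?E")
    by (auto simp: carefree_at_def)
  then have "card ?B = card (?C \<union> ?D \<union> ?E)" by (rule arg_cong)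
  also have "\<dots> \<le> card (?C \<union> ?D) + card ?E" by (rule card_Un_le)
  also have "card (?C \<union> ?D) \<le> card ?C + card ?D" by (rule card_Un_le)
  finally have "card ?B \<le> card (?M (p\<^sup>2)) * X + X * card (?M (p\<^sup>2)) + card (?M p) * card (?M p)"
    unfolding card_cartesian_product card_atLeastAtMost diff_Suc_1 by simp
  from of_nat_mono[OF this, where 'a = real]
  have "real (card {(a, b) \<in> {1..X} \<times> {1..X}. \<not> carefree_at p a b})
      \<le> real (card (?M (p\<^sup>2))) * real X + real X * real (card (?M (p\<^sup>2))) + real (card (?M p)) * real (card (?M p))"
    by (simp only: of_nat_add of_nat_mult)
  also have "\<dots> \<le> real X / real (p\<^sup>2) * real X + real X * (real X / real (p\<^sup>2)) + real X / real p * (real X / real p)"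
    using card_multiples_le[of "p\<^sup>2" X] card_multiples_le[of p X] assms
    by (intro add_mono mult_mono) auto
  also have "\<dots> = 3 * (real X)\<^sup>2 / (real p)\<^sup>2" by (simp add: power2_eq_square)
  finally show ?thesis .
qed

text \<open>Telescoping with 1 / (n + 1)^2 <= 1 / n - 1 / (n + 1); keeping the term - 1 / X makes
  the induction close.\<close>

lemma sum_inverse_squares_le:
  assumes "z > 0" "z \<le> X"
  shows "(\<Sum>n\<in>{z<..X}. 1 / (real n)\<^sup>2) \<le> 1 / real z - 1 / real X"
  using assms(2)
proof (induction X rule: dec_induct)
  case (step n)
  have "{z<..Suc n} = insert (Suc n) {z<..n}" using step by auto
  moreover have "1 / (real (Suc n))\<^sup>2 \<le> 1 / real n - 1 / real (Suc n)"
    using step assms(1) by (simp add: divide_simps power2_eq_square)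
  ultimately show ?case using step.IH by simp
qed simp

text \<open>A point lost beyond z fails \<open>carefree_at\<close> at some prime p > z, so a union
  bound over p in the box of side X applies. Since X^2 <= R N, dividing by N leaves a bound
  independent of N.\<close>

lemma sieve_tail_le:
  fixes Q :: "nat \<Rightarrow> nat \<Rightarrow> nat \<Rightarrow> bool"
  assumes R: "R \<ge> 1" and N: "N > 0" and z: "z > 0"
    and Q: "\<And>p a b. prime p \<Longrightarrow> z < p \<Longrightarrow> carefree_at p a b \<Longrightarrow> Q p a b"
  shows "\<bar>real (card {(a, b) \<in> hyp_region N R. \<forall>p. prime p \<longrightarrow> Q p a b}) / N
    - real (card {(a, b) \<in> hyp_region N R. \<forall>p\<le>z. prime p \<longrightarrow> Q p a b}) / N\<bar> \<le> 3 * R / real z"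
proof -
  let ?A = "{(a, b) \<in> hyp_region N R. \<forall>p. prime p \<longrightarrow> Q p a b}"
  let ?B = "{(a, b) \<in> hyp_region N R. \<forall>p\<le>z. prime p \<longrightarrow> Q p a b}"
  define X where "X = nat \<lfloor>sqrt (R * N)\<rfloor>"
  have "real X \<le> sqrt (R * N)" using R N by (simp add: X_def)
  then have "(real X)\<^sup>2 \<le> (sqrt (R * N))\<^sup>2" by (intro power_mono) auto
  then have X2: "(real X)\<^sup>2 \<le> R * N" using R N by simp
  have finB: "finite ?B" by (rule finite_subset[OF _ finite_hyp_region[OF R, of N]]) auto
  have AB: "?A \<subseteq> ?B" by auto
  let ?C = "\<lambda>p. {(a, b) \<in> {1..X} \<times> {1..X}. \<not> carefree_at p a b}"
  have "?B - ?A \<subseteq> (\<Union>p\<in>{z<..X}. ?C p)"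
  proof
    fix w assume w: "w \<in> ?B - ?A"
    then obtain a b where ab: "w = (a, b)" "(a, b) \<in> hyp_region N R" by auto
    obtain p where p: "prime p" "\<not> Q p a b" using w ab by auto
    then have "\<not> p \<le> z" using w ab by auto
    then have "z < p" by simp
    then have nc: "\<not> carefree_at p a b" using Q p by blast
    have X: "a \<in> {1..X}" "b \<in> {1..X}" using hyp_region_subset[OF R, of N] ab by (auto simp: X_def)
    \<comment> \<open>Failure at p forces p to divide a coordinate, which confines p to the finite
      range up to \<open>X\<close>.\<close>
    from nc have "p dvd a \<or> p dvd b"
      unfolding carefree_at_def power2_eq_square by (meson dvd_mult_left)
    then have "p \<le> X" using X by (auto dest!: dvd_imp_le)
    then show "w \<in> (\<Union>p\<in>{z<..X}. ?C p)" using \<open>z < p\<close> nc X ab by auto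
  qed
  then have "card (?B - ?A) \<le> card (\<Union>p\<in>{z<..X}. ?C p)"
    by (intro card_mono finite_UN_I) (auto intro: finite_subset[of _ "{1..X} \<times> {1..X}"])
  also have "\<dots> \<le> (\<Sum>p\<in>{z<..X}. card (?C p))" by (rule card_UN_le) simp
  finally have "real (card (?B - ?A)) \<le> (\<Sum>p\<in>{z<..X}. real (card (?C p)))"
    by (simp flip: of_nat_sum)
  also have "\<dots> \<le> (\<Sum>p\<in>{z<..X}. 3 * (real X)\<^sup>2 / (real p)\<^sup>2)"
    by (intro sum_mono card_not_carefree_at_le) auto
  also have "\<dots> = 3 * (real X)\<^sup>2 * (\<Sum>p\<in>{z<..X}. 1 / (real p)\<^sup>2)"
    by (simp add: sum_distrib_left)
  also have "\<dots> \<le> 3 * (R * N) * (1 / real z)"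
  proof (intro mult_mono)
    show "(\<Sum>p\<in>{z<..X}. 1 / (real p)\<^sup>2) \<le> 1 / real z"
    proof (cases "z \<le> X")
      case True
      have "1 / real z - 1 / real X \<le> 1 / real z" by simp
      then show ?thesis using sum_inverse_squares_le[OF z True] by linarith
    qed simp
  qed (use X2 R N in \<open>auto intro: sum_nonneg\<close>)
  finally have "real (card (?B - ?A)) / N \<le> 3 * R / real z"
    using N z by (simp add: field_simps)
  moreover have "real (card (?B - ?A)) = real (card ?B) - real (card ?A)"
    using card_Diff_subset[OF finite_subset[OF AB finB] AB] card_mono[OF finB AB] by simp
  ultimately show ?thesis using N
    by (simp add: diff_divide_distrib[symmetric] abs_minus_commute)
qed

section \<open>Interchange of the limits\<close>

text \<open>One sufficiently large z is fixed before x moves, so the range where \<open>f\<close> is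
  close to \<open>g z\<close> may depend on z, as it does for counts whose modulus depends on
  z.\<close>

lemma tendsto_uniform_approx:
  fixes f :: "'a \<Rightarrow> real"
  assumes g: "\<And>z. (g z \<longlongrightarrow> c z) F" and c: "c \<longlonglongrightarrow> L" and e: "e \<longlonglongrightarrow> 0"
    and fg: "\<forall>\<^sub>F z in sequentially. \<forall>\<^sub>F x in F. \<bar>f x - g z x\<bar> \<le> e z"
  shows "(f \<longlongrightarrow> L) F"
proof (rule tendstoI)
  fix r :: real assume "r > 0"
  then have r: "r / 3 > 0" by simp
  have "\<forall>\<^sub>F z in sequentially. (\<forall>\<^sub>F x in F. \<bar>f x - g z x\<bar> \<le> e z) \<and> \<bar>c z - L\<bar> < r / 3 \<and> \<bar>e z\<bar> < r / 3"
    using fg tendstoD[OF c r] tendstoD[OF e r] by eventually_elim (simp add: dist_real_def)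
  then obtain z where z: "\<forall>\<^sub>F x in F. \<bar>f x - g z x\<bar> \<le> e z" "\<bar>c z - L\<bar> < r / 3" "\<bar>e z\<bar> < r / 3"
    using eventually_happens'[OF sequentially_bot] by blast
  show "\<forall>\<^sub>F x in F. dist (f x) L < r"
    using z(1) tendstoD[OF g[of z] r]
    by eventually_elim (use z in \<open>unfold dist_real_def, linarith\<close>)
qed

text \<open>Stated for a general family \<open>Q\<close> that \<open>carefree_at\<close> implies
  beyond \<open>k\<close>, so that it serves both the full count and type II, where the condition is
  altered at 3.\<close>

lemma local_conditions_density:
  fixes Q :: "nat \<Rightarrow> nat \<Rightarrow> nat \<Rightarrow> bool"
  assumes R: "R \<ge> 1"
    and per: "\<And>p. prime p \<Longrightarrow> periodic2 (p\<^sup>2) (Q p)"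
    and Q: "\<And>p a b. prime p \<Longrightarrow> k < p \<Longrightarrow> carefree_at p a b \<Longrightarrow> Q p a b"
    and lim: "(\<lambda>z. \<Prod>p\<le>z. if prime p then real (card (residue_pairs (p\<^sup>2) (Q p))) / real p ^ 4 else 1)
      \<longlonglongrightarrow> C"
  shows "((\<lambda>N. real (card {(a, b) \<in> hyp_region N R. \<forall>p. prime p \<longrightarrow> Q p a b}) / N) \<longlongrightarrow> ln R * C) at_top"
proof (rule tendsto_uniform_approx)
  show "((\<lambda>N. real (card {(a, b) \<in> hyp_region N R. \<forall>p\<le>z. prime p \<longrightarrow> Q p a b}) / N) \<longlongrightarrow> ln R *
    (\<Prod>p\<le>z. if prime p then real (card (residue_pairs (p\<^sup>2) (Q p))) / real p ^ 4 else 1)) at_top" for z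
    using card_hyp_region_periodic_tendsto[OF R sieve_modulus_pos
        sieve_density[of Q z, OF per, THEN conjunct1]] sieve_density[of Q z, OF per, THEN conjunct2]
    by simp
  show "(\<lambda>z. ln R * (\<Prod>p\<le>z. if prime p then real (card (residue_pairs (p\<^sup>2) (Q p))) / real p ^ 4 else 1))
      \<longlonglongrightarrow> ln R * C"
    by (intro tendsto_mult tendsto_const lim)
  show "(\<lambda>z. 3 * R / real z) \<longlonglongrightarrow> 0" by real_asymp
  show "\<forall>\<^sub>F z in sequentially. \<forall>\<^sub>F N in at_top.
     \<bar>real (card {(a, b) \<in> hyp_region N R. \<forall>p. prime p \<longrightarrow> Q p a b}) / N
    - real (card {(a, b) \<in> hyp_region N R. \<forall>p\<le>z. prime p \<longrightarrow> Q p a b}) / N\<bar> \<le> 3 * R / real z"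
    using eventually_gt_at_top[of 0] eventually_ge_at_top[of k]
  proof eventually_elim
    case (elim z)
    show ?case using eventually_gt_at_top[of 0]
      by eventually_elim (intro sieve_tail_le R Q, use elim in auto)
  qed
qed

section \<open>Local densities, in general and for type II at 3\<close>

lemma periodic2_carefree_at: "periodic2 (p\<^sup>2) (carefree_at p)"
proof -
  have "p dvd a mod p\<^sup>2 \<longleftrightarrow> p dvd a" for a by (rule dvd_mod_iff) (simp add: power2_eq_square)
  moreover have "p\<^sup>2 dvd a mod p\<^sup>2 \<longleftrightarrow> p\<^sup>2 dvd a" for a by (rule dvd_mod_iff) simp
  ultimately show ?thesis unfolding periodic2_def carefree_at_def by simp
qed

text \<open>With p^2 - p units and p - 1 nonzero nonunits modulo p^2, the count is p (p - 1)^2 (p +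
  2), and (p - 1)^2 (p + 2) = p^3 - 3 p + 2.\<close>

lemma card_residue_pairs_carefree_at:
  assumes p: "prime p"
  shows "real (card (residue_pairs (p\<^sup>2) (carefree_at p))) / real p ^ 4 = carefree_factor p"
proof -
  have p0: "p \<ge> 1" using prime_ge_1_nat[OF p] .
  define Z where "Z = {a. a < p\<^sup>2 \<and> p dvd a \<and> a \<noteq> 0}"
  define U where "U = {a. a < p\<^sup>2 \<and> \<not> p dvd a}"
  have fin: "finite Z" "finite U" by (auto simp: Z_def U_def)
  have "Z = (\<lambda>k. p * k) ` {1..<p}"
  proof (intro equalityI subsetI)
    fix a assume "a \<in> Z"
    then obtain k where k: "a = p * k" "p * k < p\<^sup>2" "p * k \<noteq> 0" by (auto simp: Z_def)
    then have "k \<in> {1..<p}" by (auto simp: power2_eq_square)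
    then show "a \<in> (\<lambda>k. p * k) ` {1..<p}" using k by blast
  qed (use p0 in \<open>auto simp: Z_def power2_eq_square\<close>)
  then have "card Z = p - 1" using p0 by (simp add: card_image inj_on_def)
  then have cZ: "real (card Z) = real p - 1" using p0 by simp
  have "{..<p\<^sup>2} = insert 0 (Z \<union> U)" using p0 by (auto simp: Z_def U_def)
  moreover have "0 \<notin> Z \<union> U" "Z \<inter> U = {}" by (auto simp: Z_def U_def)
  ultimately have "p\<^sup>2 = 1 + card Z + card U"
    using fin by (metis card_Un_disjoint card_insert_disjoint card_lessThan finite_UnI plus_1_eq_Suc add.assoc)
  then have "real (p\<^sup>2) = 1 + real (card Z) + real (card U)" by linarith
  then have cU: "real (card U) = (real p)\<^sup>2 - real p" using cZ by simp
  have Zp: "p\<^sup>2 dvd a \<Longrightarrow> p dvd a" for a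
    by (metis dvd_mult_left power2_eq_square)
  have small: "a < p\<^sup>2 \<Longrightarrow> p\<^sup>2 dvd a \<longleftrightarrow> a = 0" for a by (auto dest: dvd_imp_le)
  \<comment> \<open>\<open>U\<close> are the units and \<open>Z\<close> the nonzero nonunits modulo \<open>p\<^sup>2\<close>.\<close>
  have "residue_pairs (p\<^sup>2) (carefree_at p) = U \<times> (U \<union> Z) \<union> Z \<times> U"
    by (auto simp: residue_pairs_def carefree_at_def U_def Z_def small)
  moreover have "U \<times> (U \<union> Z) \<inter> Z \<times> U = {}" "U \<inter> Z = {}" by (auto simp: U_def Z_def)
  ultimately have "card (residue_pairs (p\<^sup>2) (carefree_at p)) = card U * (card U + card Z) + card Z * card U"
    using fin by (simp add: card_Un_disjoint card_cartesian_product)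
  then have "real (card (residue_pairs (p\<^sup>2) (carefree_at p)))
      = ((real p)\<^sup>2 - real p) * (((real p)\<^sup>2 - real p) + (real p - 1)) + (real p - 1) * ((real p)\<^sup>2 - real p)"
    by (simp add: cU cZ)
  then show ?thesis using p p0
    by (simp add: carefree_factor_def field_simps power2_eq_square power3_eq_cube power4_eq_xxxx)
qed

definition type_II_at :: "nat \<Rightarrow> nat \<Rightarrow> nat \<Rightarrow> bool" where
  "type_II_at p a b \<longleftrightarrow> (if p = 3 then \<not> 3 dvd a * b \<and> [a\<^sup>2 = b\<^sup>2] (mod 9) else carefree_at p a b)"

lemma periodic2_type_II_at: "periodic2 (p\<^sup>2) (type_II_at p)"
proof (cases "p = 3")
  case True
  have "3 dvd a mod 9 \<longleftrightarrow> 3 dvd a" for a :: nat by (rule dvd_mod_iff) simp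
  moreover have "[(a mod 9)\<^sup>2 = (b mod 9)\<^sup>2] (mod 9) \<longleftrightarrow> [a\<^sup>2 = b\<^sup>2] (mod 9)" for a b :: nat
    by (simp add: cong_def power_mod)
  ultimately show ?thesis
    using True unfolding periodic2_def type_II_at_def by (simp add: prime_dvd_mult_iff)
next
  case False
  then show ?thesis using periodic2_carefree_at[of p] by (simp add: periodic2_def type_II_at_def)
qed

text \<open>The unit group modulo 9 is cyclic of order 6, so each of the 6 units a admits exactly b
  = a and b = -a. The proof counts by enumeration.\<close>

lemma card_residue_pairs_type_II_at_3: "card (residue_pairs 9 (type_II_at 3)) = 12"
proof -
  let ?l = "filter (\<lambda>(a, b). \<not> 3 dvd a * b \<and> a\<^sup>2 mod 9 = b\<^sup>2 mod 9) (List.product [0..<9] [0..<9::nat])"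
  have "residue_pairs 9 (type_II_at 3) = set ?l"
    by (auto simp: residue_pairs_def type_II_at_def cong_def)
  moreover have "distinct ?l" by (intro distinct_filter distinct_product) auto
  ultimately have "card (residue_pairs 9 (type_II_at 3)) = length ?l" by (simp only: distinct_card)
  also have "\<dots> = 12" by code_simp
  finally show ?thesis .
qed

section \<open>From the couples to the local conditions, and the asymptotics\<close>

lemma strongly_carefree_iff:
  assumes "a \<ge> 1" "b \<ge> 1"
  shows "strongly_carefree a b \<longleftrightarrow> (\<forall>p. prime p \<longrightarrow> carefree_at p a b)"
proof -
  have "coprime a b \<longleftrightarrow> (\<forall>p. prime p \<longrightarrow> \<not> (p dvd a \<and> p dvd b))"
  proof
    assume "coprime a b"
    then show "\<forall>p. prime p \<longrightarrow> \<not> (p dvd a \<and> p dvd b)"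
      by (meson coprime_common_divisor not_prime_unit)
  next
    assume "\<forall>p. prime p \<longrightarrow> \<not> (p dvd a \<and> p dvd b)"
    then have "gcd a b = 1"
      by (metis prime_factor_nat gcd_dvd1 gcd_dvd2 dvd_trans)
    then show "coprime a b" by (simp only: coprime_iff_gcd_eq_1)
  qed
  then show ?thesis
    using assms unfolding strongly_carefree_def carefree_at_def
    by (auto simp: squarefree_factorial_semiring)
qed

lemma carefree_couples_eq:
  assumes R: "R \<ge> 1"
  shows "carefree_couples N R = {(a, b) \<in> hyp_region N R. \<forall>p. prime p \<longrightarrow> carefree_at p a b}"
proof -
  have *: "(a, b) \<in> hyp_region N R \<longleftrightarrow> a \<ge> 1 \<and> b \<ge> 1 \<and> real a * real b \<le> N \<and> 1 / R \<le> real a / real b \<and> real a / real b \<le> R" for a b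
  proof -
    have "(a, b) \<in> hyp_region N R \<Longrightarrow> a \<ge> 1" using hyp_region_bounds[OF _ R] by blast
    then show ?thesis using R by (auto simp: hyp_region_def field_simps)
  qed
  have "strongly_carefree a b \<Longrightarrow> a \<ge> 1 \<and> b \<ge> 1" for a b by (simp add: strongly_carefree_def)
  then have "strongly_carefree a b \<and> real a * real b \<le> N \<and> 1 / R \<le> real a / real b \<and> real a / real b \<le> R
      \<longleftrightarrow> (a, b) \<in> hyp_region N R \<and> (\<forall>p. prime p \<longrightarrow> carefree_at p a b)" for a b
    unfolding * using strongly_carefree_iff by blast
  then show ?thesis unfolding carefree_couples_def by simp
qed

text \<open>A product prime to 3 has both factors prime to 3. Hence the condition at 3 can replace
  \<open>carefree_at 3\<close> and still describe a subset of the strongly carefree couples.\<close>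

lemma type_II_at_3_imp:
  assumes "type_II_at 3 a b"
  shows "carefree_at 3 a b"
proof -
  have "\<not> 3 dvd a" "\<not> 3 dvd b" using assms unfolding type_II_at_def by (simp_all add: prime_dvd_mult_iff[of "3::nat"])
  moreover have "(3::nat)\<^sup>2 dvd x \<Longrightarrow> 3 dvd x" for x
    using dvd_trans[OF dvd_power[of 2 "3::nat"], of x] by simp
  ultimately show ?thesis unfolding carefree_at_def by blast
qed

lemma carefree_couples_II_eq:
  assumes R: "R \<ge> 1"
  shows "carefree_couples_II N R = {(a, b) \<in> hyp_region N R. \<forall>p. prime p \<longrightarrow> type_II_at p a b}"
proof -
  have "(\<forall>p. prime p \<longrightarrow> carefree_at p a b) \<and> \<not> 3 dvd a * b \<and> [a\<^sup>2 = b\<^sup>2] (mod 9)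
      \<longleftrightarrow> (\<forall>p. prime p \<longrightarrow> type_II_at p a b)" for a b
  proof
    assume *: "\<forall>p. prime p \<longrightarrow> type_II_at p a b"
    have "carefree_at p a b" if "prime p" for p
    proof (cases "p = 3")
      case True
      then show ?thesis using * type_II_at_3_imp that by blast
    next
      case False
      then show ?thesis using * that by (auto simp: type_II_at_def)
    qed
    moreover have "type_II_at 3 a b" using * by simp
    ultimately show "(\<forall>p. prime p \<longrightarrow> carefree_at p a b) \<and> \<not> 3 dvd a * b \<and> [a\<^sup>2 = b\<^sup>2] (mod 9)"
      by (auto simp: type_II_at_def)
  qed (auto simp: type_II_at_def)
  then show ?thesis unfolding carefree_couples_II_def carefree_couples_eq[OF R] by blast
qed

lemma prod_carefree_factor_LIMSEQ: "(\<lambda>z. \<Prod>p\<le>z. carefree_factor p) \<longlonglongrightarrow> carefree_const"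
  unfolding carefree_const_def by (rule convergent_prod_LIMSEQ[OF convergent_prod_carefree_factor])

lemma S_tendsto:
  assumes R: "R \<ge> 1"
  shows "((\<lambda>N. S N R / N) \<longlongrightarrow> ln R * carefree_const) at_top"
proof -
  have eq: "(if prime p then real (card (residue_pairs (p\<^sup>2) (carefree_at p))) / real p ^ 4 else 1)
      = carefree_factor p" for p
    using card_residue_pairs_carefree_at[of p] by (auto simp: carefree_factor_def)
  show ?thesis
    unfolding S_def carefree_couples_eq[OF R]
  proof (rule local_conditions_density[OF R periodic2_carefree_at])
    show "(\<lambda>z. \<Prod>p\<le>z. if prime p then real (card (residue_pairs (p\<^sup>2) (carefree_at p))) / real p ^ 4 else 1)
        \<longlonglongrightarrow> carefree_const"
      unfolding eq by (rule prod_carefree_factor_LIMSEQ)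
  qed
qed

text \<open>The partial products for type II differ from the carefree ones only in the factor at 3,
  so from z = 3 on they are exactly one fifth of them, and the limit inherits this.\<close>

lemma S_II_tendsto:
  assumes R: "R \<ge> 1"
  shows "((\<lambda>N. S_II N R / N) \<longlongrightarrow> ln R * (carefree_const / 5)) at_top"
proof -
  let ?d = "\<lambda>p. if prime p then real (card (residue_pairs (p\<^sup>2) (type_II_at p))) / real p ^ 4 else 1"
  have eq: "?d p = carefree_factor p" if "p \<noteq> 3" for p
  proof -
    have "type_II_at p = carefree_at p" using that by (intro ext) (simp add: type_II_at_def)
    then show ?thesis using card_residue_pairs_carefree_at[of p] by (auto simp: carefree_factor_def)
  qed
  \<comment> \<open>Here 12 / 81 = 4 / 27, while \<open>carefree_factor 3\<close> is 20 /
    27.\<close>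
  have eq3: "?d 3 = carefree_factor 3 / 5"
    using card_residue_pairs_type_II_at_3 by (simp add: carefree_factor_def)
  have "(\<Prod>p\<le>z. carefree_factor p) / 5 = (\<Prod>p\<le>z. ?d p)" if "z \<ge> 3" for z
  proof -
    have "(\<Prod>p\<le>z. ?d p) = ?d 3 * (\<Prod>p\<in>{..z} - {3}. ?d p)"
      using that by (intro prod.remove) auto
    also have "(\<Prod>p\<in>{..z} - {3}. ?d p) = (\<Prod>p\<in>{..z} - {3}. carefree_factor p)"
      by (rule prod.cong) (use eq in auto)
    also have "?d 3 * \<dots> = carefree_factor 3 * (\<Prod>p\<in>{..z} - {3}. carefree_factor p) / 5"
      unfolding eq3 by simp
    also have "carefree_factor 3 * (\<Prod>p\<in>{..z} - {3}. carefree_factor p) = (\<Prod>p\<le>z. carefree_factor p)"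
      using that by (intro prod.remove[symmetric]) auto
    finally show ?thesis ..
  qed
  then have "\<forall>\<^sub>F z in sequentially. (\<Prod>p\<le>z. carefree_factor p) / 5 = (\<Prod>p\<le>z. ?d p)"
    using eventually_sequentially by blast
  moreover have "(\<lambda>z. (\<Prod>p\<le>z. carefree_factor p) / 5) \<longlonglongrightarrow> carefree_const / 5"
    by (intro tendsto_divide prod_carefree_factor_LIMSEQ) auto
  ultimately have "(\<lambda>z. \<Prod>p\<le>z. ?d p) \<longlonglongrightarrow> carefree_const / 5"
    by (rule Lim_transform_eventually[rotated])
  then show ?thesis
    unfolding S_II_def carefree_couples_II_eq[OF R]
    by (intro local_conditions_density[where k = 3, OF R periodic2_type_II_at])
      (simp_all add: type_II_at_def)
qed

lemma smallo_if_quotient_tendsto: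
  fixes f :: "real \<Rightarrow> real"
  assumes "((\<lambda>N. f N / N) \<longlongrightarrow> c) at_top"
  shows "(\<lambda>N. f N - c * N) \<in> o[at_top](\<lambda>N. N)"
proof (rule smalloI_tendsto)
  have "((\<lambda>N. f N / N - c) \<longlongrightarrow> 0) at_top" using assms by (simp add: LIM_zero)
  moreover have "\<forall>\<^sub>F N in at_top. f N / N - c = (f N - c * N) / N"
    using eventually_gt_at_top[of 0] by eventually_elim (simp add: field_simps)
  ultimately show "((\<lambda>N. (f N - c * N) / N) \<longlongrightarrow> 0) at_top"
    by (rule Lim_transform_eventually)
  show "\<forall>\<^sub>F N in at_top. N \<noteq> (0::real)" using eventually_gt_at_top[of 0] by eventually_elim simp
qed

theorem theorem3p3:
  fixes R :: real
  assumes "R \<ge> 1"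
  shows "(\<lambda>N. S_I N R - 4 * carefree_const / 5 * N * ln R) \<in> o[at_top](\<lambda>N. N) \<and>
         (\<lambda>N. S_II N R - carefree_const / 5 * N * ln R) \<in> o[at_top](\<lambda>N. N) \<and>
         (\<lambda>N. S N R - carefree_const * N * ln R) \<in> o[at_top](\<lambda>N. N)"
proof -
  note S = S_tendsto[OF assms] and II = S_II_tendsto[OF assms]
  \<comment> \<open>Type I is the complement, so its constant is C - C / 5 = 4 C / 5.\<close>
  have "((\<lambda>N. S_I N R / N) \<longlongrightarrow> ln R * carefree_const - ln R * (carefree_const / 5)) at_top"
    using tendsto_diff[OF S II] by (simp add: S_I_def diff_divide_distrib)
  from smallo_if_quotient_tendsto[OF this] smallo_if_quotient_tendsto[OF II] smallo_if_quotient_tendsto[OF S]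
  show ?thesis by (simp add: algebra_simps)
qed

end
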